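(* (1) $\mathrm{PSD}\subset\mathrm{PSD[O]}\subset\mathrm{PSD[T,O]}$; (2) $\mathrm{PSD}\subset\mathrm{PSD[T]}\subset\mathrm{PSD[T,O]}$; (3) $\mathrm{PSD[O]}\setminus\mathrm{PSD[T]}\neq\emptyset$; (4) $\mathrm{PSD[T]}\setminus\mathrm{PSD[O]}\neq\emptyset$. Here $\subset$ denotes proper inclusion.
   Context: An indexed family is a sequence $\mathcal F=(F_n)_{n\in\mathbb N}$ of subsets of $\mathbb N$ that is uniformly computably enumerable; $F\in\mathcal F$ means $F=F_n$ for some $n$, and $\mathrm{mi}_{\mathcal F}(F)$ is the least $n$ with $F_n=F$. An enumeration of a nonempty set $A$ is an infinite sequence of elements of $A$ in which every element of $A$ occurs; $f\restriction n$ is its initial segment of length $n$, and $\mathrm{content}(\sigma)$ is the set of entries of a finite string $\sigma$. A learner is a partial computable function from finite strings of naturals to naturals; hypothesis $h$ is interpreted as $F_h$. $\mathcal F$ is PSD-learnable if there are a learner $M$ and a polynomial $p$ such that for every $F\in\mathcal F$ and every enumeration $f$ of $F$, there is $n$ with $|\mathrm{content}(f\restriction n)|<p(\mathrm{mi}_{\mathcal F}(F))$ such that $M(f\restriction j)=M(f\restriction n)$ for all $j\ge n$ and $F_{M(f\restriction n)}=F$; if an oracle is used, the number of oracle queries is also bounded by $p(\mathrm{mi}_{\mathcal F}(F))$. A teacher is a computable map $T$ on finite strings with $T(\sigma)$ a prefix of $T(\tau)$ whenever $\sigma$ is a prefix of $\tau$, and $\mathrm{content}(T(\sigma))\subseteq\mathrm{content}(\sigma)$.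 PSD[O]-learnable: some learner with a membership oracle for the target set PSD-learns $\mathcal F$. PSD[T]-learnable: there is a learner-teacher pair $(M,T)$ such that $M$, fed $T(f\restriction n)$ in place of $f\restriction n$ (i.e. on the data stream $T\circ f$), meets the PSD criterion for every enumeration $f$ of every member of $\mathcal F$. PSD[T,O]-learnable: as for PSD[T], but $M$ additionally has a membership oracle for the target and $T$ has access to the oracle answers $M$ receives. PSD, PSD[O], PSD[T], PSD[T,O] denote the corresponding classes of indexed families. *)

theory Defs
  imports "HOL-Library.Nat_Bijection" "HOL-Library.Sublist" "HOL-Computational_Algebra.Polynomial"
begin

datatype recf =
    Zero
  | Succ
  | Proj nat
  | Comp recf "recf list"
  | PrimRec recf recf
  | Mu recf
  | Oracle

inductive ev :: "nat set \<Rightarrow> recf \<Rightarrow> nat list \<Rightarrow> nat \<Rightarrow> nat list \<Rightarrow> bool"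
  and evs :: "nat set \<Rightarrow> recf list \<Rightarrow> nat list \<Rightarrow> nat list \<Rightarrow> nat list \<Rightarrow> bool"
  and evmu :: "nat set \<Rightarrow> recf \<Rightarrow> nat list \<Rightarrow> nat \<Rightarrow> nat \<Rightarrow> nat list \<Rightarrow> bool"
  for A :: "nat set"
where
  ev_zero: "ev A Zero xs 0 []"
| ev_succ: "ev A Succ (x # xs) (Suc x) []"
| ev_proj: "i < length xs \<Longrightarrow> ev A (Proj i) xs (xs ! i) []"
| ev_oracle: "ev A Oracle (x # xs) (if x \<in> A then 1 else 0) [x]"
| ev_comp: "evs A gs xs ys qs \<Longrightarrow> ev A f ys y q \<Longrightarrow> ev A (Comp f gs) xs y (qs @ q)"
| ev_prim0: "ev A f xs y q \<Longrightarrow> ev A (PrimRec f g) (0 # xs) y q"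
| ev_primS: "ev A (PrimRec f g) (n # xs) r q \<Longrightarrow> ev A g (n # r # xs) y q'
              \<Longrightarrow> ev A (PrimRec f g) (Suc n # xs) y (q @ q')"
| ev_mu: "evmu A f xs 0 y q \<Longrightarrow> ev A (Mu f) xs y q"
| evs_nil: "evs A [] xs [] []"
| evs_cons: "ev A g xs y q \<Longrightarrow> evs A gs xs ys qs \<Longrightarrow> evs A (g # gs) xs (y # ys) (q @ qs)"
| evmu_found: "ev A f (n # xs) 0 q \<Longrightarrow> evmu A f xs n n q"
| evmu_next: "ev A f (n # xs) (Suc k) q \<Longrightarrow> evmu A f xs (Suc n) y q'
              \<Longrightarrow> evmu A f xs n y (q @ q')"

fun oracle_free :: "recf \<Rightarrow> bool" where
  "oracle_free Oracle = False"
| "oracle_free (Comp f gs) = (oracle_free f \<and> (\<forall>g\<in>set gs. oracle_free g))"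
| "oracle_free (PrimRec f g) = (oracle_free f \<and> oracle_free g)"
| "oracle_free (Mu f) = oracle_free f"
| "oracle_free _ = True"

definition conv :: "nat set \<Rightarrow> recf \<Rightarrow> nat list \<Rightarrow> bool" where
  "conv A M \<sigma> = (\<exists>y q. ev A M [list_encode \<sigma>] y q)"

definition res :: "nat set \<Rightarrow> recf \<Rightarrow> nat list \<Rightarrow> nat" where
  "res A M \<sigma> = (THE y. \<exists>q. ev A M [list_encode \<sigma>] y q)"

definition queries :: "nat set \<Rightarrow> recf \<Rightarrow> nat list \<Rightarrow> nat list" where
  "queries A M \<sigma> = (THE q. \<exists>y. ev A M [list_encode \<sigma>] y q)"

definition indexed_family :: "(nat \<Rightarrow> nat set) \<Rightarrow> bool" where
  "indexed_family F = (\<exists>e. oracle_free e \<and>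
      (\<forall>n x. x \<in> F n \<longleftrightarrow> (\<exists>y q. ev {} e [n, x] y q)))"

definition mi :: "(nat \<Rightarrow> nat set) \<Rightarrow> nat set \<Rightarrow> nat" where
  "mi F S = (LEAST n. F n = S)"

definition enumeration :: "(nat \<Rightarrow> nat) \<Rightarrow> nat set \<Rightarrow> bool" where
  "enumeration f S = (S \<noteq> {} \<and> range f = S)"

definition restr :: "(nat \<Rightarrow> nat) \<Rightarrow> nat \<Rightarrow> nat list" where
  "restr f n = map f [0..<n]"

text \<open>A teacher with access to the oracle answers: a computable map taking the data
  seen so far and the list of (query, answer) pairs received by the learner so far.
  A plain teacher is one that ignores the second argument.\<close>

definition enc_hist :: "(nat \<times> bool) list \<Rightarrow> nat" where
  "enc_hist H = list_encode (map (\<lambda>(x, b). prod_encode (x, if b then 1 else 0)) H)"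

definition teacher :: "(nat list \<Rightarrow> nat list) \<Rightarrow> bool" where
  "teacher T = ((\<exists>t. oracle_free t \<and> (\<forall>\<sigma>. \<exists>q. ev {} t [list_encode \<sigma>] (list_encode (T \<sigma>)) q))
     \<and> (\<forall>\<sigma> \<tau>. prefix \<sigma> \<tau> \<longrightarrow> prefix (T \<sigma>) (T \<tau>))
     \<and> (\<forall>\<sigma>. set (T \<sigma>) \<subseteq> set \<sigma>))"

definition teacher_O :: "(nat list \<Rightarrow> (nat \<times> bool) list \<Rightarrow> nat list) \<Rightarrow> bool" where
  "teacher_O T = ((\<exists>t. oracle_free t \<and>
        (\<forall>\<sigma> H. \<exists>q. ev {} t [list_encode \<sigma>, enc_hist H] (list_encode (T \<sigma> H)) q))
     \<and> (\<forall>\<sigma> \<tau> H H'. prefix \<sigma> \<tau> \<longrightarrow> prefix H H' \<longrightarrow> prefix (T \<sigma> H) (T \<tau> H'))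
     \<and> (\<forall>\<sigma> H. set (T \<sigma> H) \<subseteq> set \<sigma>))"

primrec hist :: "nat set \<Rightarrow> recf \<Rightarrow> (nat list \<Rightarrow> (nat \<times> bool) list \<Rightarrow> nat list)
                  \<Rightarrow> (nat \<Rightarrow> nat) \<Rightarrow> nat \<Rightarrow> (nat \<times> bool) list" where
  "hist A M T f 0 = []"
| "hist A M T f (Suc n) =
     (let d = T (restr f n) (hist A M T f n) in
      hist A M T f n @
        (if conv A M d then map (\<lambda>x. (x, x \<in> A)) (queries A M d) else []))"

definition data :: "nat set \<Rightarrow> recf \<Rightarrow> (nat list \<Rightarrow> (nat \<times> bool) list \<Rightarrow> nat list)
                  \<Rightarrow> (nat \<Rightarrow> nat) \<Rightarrow> nat \<Rightarrow> nat list" where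
  "data A M T f n = T (restr f n) (hist A M T f n)"

definition psd_crit :: "(nat \<Rightarrow> nat set) \<Rightarrow> recf \<Rightarrow> (nat list \<Rightarrow> (nat \<times> bool) list \<Rightarrow> nat list)
                        \<Rightarrow> nat poly \<Rightarrow> bool" where
  "psd_crit F M T p = (\<forall>i f. enumeration f (F i) \<longrightarrow>
     (\<exists>n. card (set (data (F i) M T f n)) < poly p (mi F (F i))
        \<and> length (hist (F i) M T f (Suc n)) < poly p (mi F (F i))
        \<and> conv (F i) M (data (F i) M T f n)
        \<and> (\<forall>j\<ge>n. conv (F i) M (data (F i) M T f j)
                 \<and> res (F i) M (data (F i) M T f j) = res (F i) M (data (F i) M T f n))
        \<and> F (res (F i) M (data (F i) M T f n)) = F i))"

definition PSD :: "(nat \<Rightarrow> nat set) set" where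
  "PSD = {F. indexed_family F \<and>
     (\<exists>M p. oracle_free M \<and> psd_crit F M (\<lambda>\<sigma> H. \<sigma>) p)}"

definition PSD_O :: "(nat \<Rightarrow> nat set) set" where
  "PSD_O = {F. indexed_family F \<and> (\<exists>M p. psd_crit F M (\<lambda>\<sigma> H. \<sigma>) p)}"

definition PSD_T :: "(nat \<Rightarrow> nat set) set" where
  "PSD_T = {F. indexed_family F \<and>
     (\<exists>M T p. oracle_free M \<and> teacher T \<and> psd_crit F M (\<lambda>\<sigma> H. T \<sigma>) p)}"

definition PSD_TO :: "(nat \<Rightarrow> nat set) set" where
  "PSD_TO = {F. indexed_family F \<and>
     (\<exists>M T p. teacher_O T \<and> psd_crit F M T p)}"

end

theory Submission
  imports Defs
begin

text \<open>A teacher can choose the data so that only boundedly many distinct elements are ever shown, so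
  \<open>PSD_T\<close> amounts to learning in the limit, whereas an oracle allows few queries but does not slow
  down the growth of the content. The natural numbers together with their finite initial segments
  are not learnable in the limit from positive data (Gold), but an oracle finds the missing
  elements. Conversely, on an injective enumeration a learner without a teacher must decide after
  polynomially many steps; simulating it for that long with a universal machine, one diagonalises
  by letting one of two competing hypotheses differ from the target only at the encoded halting
  times of the simulated computation. A teacher learns the diagonal family by passing on one element and
  the first encoded halting time that occurs, if any.\<close>

section \<open>Evaluation\<close>

inductive_cases ev_ZeroE: "ev A Zero xs y q"
inductive_cases ev_SuccE: "ev A Succ xs y q"
inductive_cases ev_ProjE: "ev A (Proj i) xs y q"
inductive_cases ev_OracleE: "ev A Oracle xs y q"
inductive_cases ev_CompE: "ev A (Comp f gs) xs y q"
inductive_cases ev_Prim0E: "ev A (PrimRec f g) (0 # xs) y q"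
inductive_cases ev_PrimSE: "ev A (PrimRec f g) (Suc n # xs) y q"
inductive_cases ev_MuE: "ev A (Mu f) xs y q"
inductive_cases evs_NilE: "evs A [] xs ys q"
inductive_cases evs_ConsE: "evs A (g # gs) xs ys q"

text \<open>Where two rules share a term, the first argument (primitive recursion) or the value of
  the body (minimisation) selects one. Uniqueness of value and trace justifies the definite
  descriptions in \<open>res\<close> and \<open>queries\<close>.\<close>

lemma ev_deterministic:
  "ev A f xs y q \<Longrightarrow> ev A f xs y' q' \<Longrightarrow> y' = y \<and> q' = q"
  "evs A gs xs ys q \<Longrightarrow> evs A gs xs ys' q' \<Longrightarrow> ys' = ys \<and> q' = q"
  "evmu A f xs n y q \<Longrightarrow> evmu A f xs n y' q' \<Longrightarrow> y' = y \<and> q' = q"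
proof (induction arbitrary: y' q' and ys' q' and y' q' rule: ev_evs_evmu.inducts)
  case (ev_comp gs xs ys qs f y q)
  from ev_comp.prems ev_comp.IH show ?case by (elim ev_CompE) blast
next
  case (ev_primS f g n xs r q y q1)
  from ev_primS.prems ev_primS.IH show ?case by (elim ev_PrimSE) blast
next
  case (evs_cons g xs y q gs ys qs)
  from evs_cons.prems evs_cons.IH show ?case by (elim evs_ConsE) blast
next
  case (evmu_found f n xs q)
  from evmu_found.prems show ?case
    by (cases rule: evmu.cases) (use evmu_found.IH in blast)+
next
  case (evmu_next f n xs k q y q1)
  from evmu_next.prems show ?case
    by (cases rule: evmu.cases) (use evmu_next.IH in blast)+
next
  case (ev_zero xs)
  then show ?case by (auto elim!: ev_ZeroE)
next
  case (ev_succ x xs)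
  then show ?case by (auto elim!: ev_SuccE)
next
  case (ev_proj i xs)
  then show ?case by (auto elim!: ev_ProjE)
next
  case (ev_oracle x xs)
  then show ?case by (auto elim!: ev_OracleE)
next
  case (ev_prim0 f xs y q g)
  from ev_prim0.prems ev_prim0.IH show ?case by (elim ev_Prim0E) blast
next
  case (ev_mu f xs y q)
  from ev_mu.prems ev_mu.IH show ?case by (elim ev_MuE) blast
next
  case (evs_nil xs)
  then show ?case by (auto elim!: evs_NilE)
qed

lemma res_queries_eq:
  assumes "ev A M [list_encode \<sigma>] y q"
  shows "conv A M \<sigma>" "res A M \<sigma> = y" "queries A M \<sigma> = q"
proof -
  show "conv A M \<sigma>" unfolding conv_def using assms by blast
  show "res A M \<sigma> = y" unfolding res_def
    by (rule the_equality) (use assms ev_deterministic(1) in blast)+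
  show "queries A M \<sigma> = q" unfolding queries_def
    by (rule the_equality) (use assms ev_deterministic(1) in blast)+
qed

lemma ev_res:
  assumes "conv A M \<sigma>"
  obtains q where "ev A M [list_encode \<sigma>] (res A M \<sigma>) q"
proof -
  from assms obtain y q where "ev A M [list_encode \<sigma>] y q" unfolding conv_def by blast
  with res_queries_eq(2)[OF this] that show thesis by simp
qed

text \<open>The oracle set enters only through the rule for \<open>Oracle\<close>, which is also the
  only one to record a query.\<close>

lemma oracle_free_ev:
  "ev A f xs y q \<Longrightarrow> oracle_free f \<Longrightarrow> ev B f xs y q \<and> q = []"
  "evs A gs xs ys q \<Longrightarrow> \<forall>g\<in>set gs. oracle_free g \<Longrightarrow> evs B gs xs ys q \<and> q = []"
  "evmu A f xs n y q \<Longrightarrow> oracle_free f \<Longrightarrow> evmu B f xs n y q \<and> q = []"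
proof (induction rule: ev_evs_evmu.inducts)
  case (ev_comp gs xs ys qs f y q)
  then show ?case using ev_evs_evmu.ev_comp[of B gs xs ys qs f y q] by auto
next
  case (ev_prim0 f xs y q g)
  then show ?case using ev_evs_evmu.ev_prim0[of B f xs y q g] by auto
next
  case (ev_primS f g n xs r q y q1)
  then show ?case using ev_evs_evmu.ev_primS[of B f g n xs r q y q1] by auto
next
  case (ev_mu f xs y q)
  then show ?case using ev_evs_evmu.ev_mu[of B f xs y q] by auto
next
  case (evs_cons g xs y q gs ys qs)
  then show ?case using ev_evs_evmu.evs_cons[of B g xs y q gs ys qs] by auto
next
  case (evmu_found f n xs q)
  then show ?case using ev_evs_evmu.evmu_found[of B f n xs q] by auto
next
  case (evmu_next f n xs k q y q1)
  then show ?case using ev_evs_evmu.evmu_next[of B f n xs k q y q1] by auto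
qed (simp_all add: ev_evs_evmu.intros)

text \<open>In the Gold argument the targets vary while the data agree; this makes hypotheses
  comparable across targets.\<close>

lemma oracle_free_res:
  assumes "oracle_free M"
  shows "res A M \<sigma> = res {} M \<sigma>"
proof -
  have "ev A M xs y q \<longleftrightarrow> ev {} M xs y q" for xs y q
    using oracle_free_ev(1) assms by blast
  then show ?thesis by (simp add: res_def)
qed

lemma ev_Mu_Least:
  assumes ev: "\<And>n. ev A e (n # xs) (f n) []" and ex: "\<exists>n. f n = 0"
  shows "ev A (Mu e) xs (LEAST n. f n = 0) []"
proof -
  define m where "m = (LEAST n. f n = 0)"
  have m: "f m = 0" unfolding m_def using ex by (rule LeastI_ex)
  \<comment> \<open>Downward induction: a search started at \<open>m\<close> stops at once, and each
    nonzero value below puts one more failed round in front.\<close>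
  have "evmu A e xs (m - i) m []" if "i \<le> m" for i
    using that
  proof (induction i)
    case 0
    show ?case using evmu_found[of A e m xs] ev[of m] m by simp
  next
    case (Suc i)
    then have "f (m - Suc i) \<noteq> 0"
      using not_less_Least[of "m - Suc i" "\<lambda>n. f n = 0"] by (simp add: m_def)
    then obtain k where "ev A e ((m - Suc i) # xs) (Suc k) []"
      using ev[of "m - Suc i"] not0_implies_Suc by metis
    from evmu_next[OF this, of m "[]"] Suc show ?case by (simp add: Suc_diff_Suc)
  qed
  from this[of m] show ?thesis by (simp add: m_def ev_mu)
qed

text \<open>Minimisation can halt only at a zero of its body. The trivial conjuncts come from the
  mutual induction.\<close>

lemma evmu_zero:
  "ev A f xs y q \<Longrightarrow> True"
  "evs A gs xs ys q \<Longrightarrow> True"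
  "evmu A f xs n y q \<Longrightarrow> \<exists>q'. ev A f (y # xs) 0 q'"
  by (induction rule: ev_evs_evmu.inducts) auto

section \<open>Total computable functions\<close>

text \<open>The length condition fixes the arity, which the terms themselves do not carry.\<close>

definition total_computable :: "nat \<Rightarrow> (nat list \<Rightarrow> nat) \<Rightarrow> bool" where
  "total_computable k g \<longleftrightarrow>
     (\<exists>e. oracle_free e \<and> (\<forall>A xs. length xs = k \<longrightarrow> ev A e xs (g xs) []))"

lemma total_computable_cong:
  assumes "total_computable k f" "\<And>xs. length xs = k \<Longrightarrow> f xs = g xs"
  shows "total_computable k g"
  using assms unfolding total_computable_def by metis

lemma total_computable_Suc: "total_computable 1 (\<lambda>xs. Suc (xs ! 0))"
  unfolding total_computable_def
  by (rule exI[of _ Succ]) (auto simp: length_Suc_conv intro: ev_succ)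

lemma total_computable_proj: "i < k \<Longrightarrow> total_computable k (\<lambda>xs. xs ! i)"
  unfolding total_computable_def by (rule exI[of _ "Proj i"]) (auto intro: ev_proj)

lemma total_computable_compose:
  assumes f: "total_computable (length gs) f" and gs: "\<forall>g\<in>set gs. total_computable k g"
  shows "total_computable k (\<lambda>xs. f (map (\<lambda>g. g xs) gs))"
proof -
  have "\<exists>es. (\<forall>e\<in>set es. oracle_free e) \<and>
      (\<forall>A xs. length xs = k \<longrightarrow> evs A es xs (map (\<lambda>g. g xs) gs) [])"
    using gs
  proof (induction gs)
    case Nil
    show ?case by (rule exI[of _ "[]"]) (auto intro: evs_nil)
  next
    case (Cons g gs)
    then obtain es e where "\<forall>e\<in>set es. oracle_free e"
      "\<forall>A xs. length xs = k \<longrightarrow> evs A es xs (map (\<lambda>g. g xs) gs) []"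
      "oracle_free e" "\<forall>A xs. length xs = k \<longrightarrow> ev A e xs (g xs) []"
      by (auto simp: total_computable_def)
    then show ?case
      by (intro exI[of _ "e # es"]) (auto intro: evs_cons[where q = "[]" and qs = "[]", simplified])
  qed
  then obtain es where "\<forall>e\<in>set es. oracle_free e"
    "\<forall>A xs. length xs = k \<longrightarrow> evs A es xs (map (\<lambda>g. g xs) gs) []" by blast
  moreover from f obtain e where "oracle_free e"
    "\<forall>A xs. length xs = length gs \<longrightarrow> ev A e xs (f xs) []"
    by (auto simp: total_computable_def)
  ultimately show ?thesis
    unfolding total_computable_def
    by (intro exI[of _ "Comp e es"])
      (auto intro!: ev_comp[where q = "[]" and qs = "[]", simplified])
qed

lemma total_computable_compose1:
  assumes "total_computable 1 (\<lambda>ys. f (ys ! 0))" "total_computable k g"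
  shows "total_computable k (\<lambda>xs. f (g xs))"
  using total_computable_compose[of "[g]" "\<lambda>ys. f (ys ! 0)" k] assms by simp

lemma total_computable_compose2:
  assumes "total_computable 2 (\<lambda>ys. f (ys ! 0) (ys ! 1))"
    "total_computable k g" "total_computable k h"
  shows "total_computable k (\<lambda>xs. f (g xs) (h xs))"
  using total_computable_compose[of "[g, h]" "\<lambda>ys. f (ys ! 0) (ys ! 1)" k] assms
  by (simp add: numeral_2_eq_2)

lemma total_computable_compose3:
  assumes "total_computable 3 (\<lambda>ys. f (ys ! 0) (ys ! 1) (ys ! 2))"
    "total_computable k g" "total_computable k h" "total_computable k i"
  shows "total_computable k (\<lambda>xs. f (g xs) (h xs) (i xs))"
  using total_computable_compose[of "[g, h, i]" "\<lambda>ys. f (ys ! 0) (ys ! 1) (ys ! 2)" k] assms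
  by (simp add: numeral_3_eq_3 numeral_2_eq_2)

lemmas compose_Suc = total_computable_compose1[where f = Suc, OF total_computable_Suc]

lemma total_computable_const: "total_computable k (\<lambda>xs. c)"
proof (induction c)
  case 0
  show ?case unfolding total_computable_def by (rule exI[of _ Zero]) (auto intro: ev_zero)
next
  case (Suc c)
  show ?case by (rule total_computable_compose1[OF total_computable_Suc Suc])
qed

text \<open>Counter, previous value, parameters: this is the order of arguments in
  \<open>ev_primS\<close>.\<close>

lemma total_computable_rec:
  assumes "total_computable k f" "total_computable (Suc (Suc k)) g"
  shows "total_computable (Suc k)
    (\<lambda>xs. rec_nat (f (tl xs)) (\<lambda>m r. g (m # r # tl xs)) (xs ! 0))"
proof -
  from assms obtain e d where e: "oracle_free e" "\<forall>A xs. length xs = k \<longrightarrow> ev A e xs (f xs) []"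
    and d: "oracle_free d" "\<forall>A xs. length xs = Suc (Suc k) \<longrightarrow> ev A d xs (g xs) []"
    by (auto simp: total_computable_def)
  have "ev A (PrimRec e d) (n # xs) (rec_nat (f xs) (\<lambda>m r. g (m # r # xs)) n) []"
    if "length xs = k" for A n xs
  proof (induction n)
    case 0
    then show ?case using e that by (auto intro: ev_prim0)
  next
    case (Suc n)
    then show ?case using d that by (auto intro!: ev_primS[where q = "[]" and q' = "[]", simplified])
  qed
  then show ?thesis
    unfolding total_computable_def using e d
    by (intro exI[of _ "PrimRec e d"]) (auto simp: length_Suc_conv)
qed

lemma total_computable_Least:
  assumes "total_computable (Suc k) f" "\<And>xs. length xs = k \<Longrightarrow> \<exists>n. f (n # xs) = 0"
  shows "total_computable k (\<lambda>xs. LEAST n. f (n # xs) = 0)"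
proof -
  from assms(1) obtain e where "oracle_free e"
    "\<forall>A xs. length xs = Suc k \<longrightarrow> ev A e xs (f xs) []"
    by (auto simp: total_computable_def)
  then show ?thesis
    unfolding total_computable_def using assms(2)
    by (intro exI[of _ "Mu e"]) (auto intro!: ev_Mu_Least)
qed

lemma total_computable_If:
  assumes "total_computable k a" "total_computable k f" "total_computable k g"
  shows "total_computable k (\<lambda>xs. if a xs = 0 then f xs else g xs)"
proof -
  \<comment> \<open>A case distinction is a primitive recursion whose step ignores the previous
    value; position 3 in the step holds the third input.\<close>
  have "total_computable (Suc 2)
      (\<lambda>xs. rec_nat (tl xs ! 0) (\<lambda>m r. (m # r # tl xs) ! 3) (xs ! 0))"
    by (intro total_computable_rec total_computable_proj) auto
  then have "total_computable 3 (\<lambda>ys. if ys ! 0 = 0 then ys ! 1 else ys ! 2)"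
    unfolding numeral_3_eq_3 numeral_2_eq_2
    by (rule total_computable_cong)
      (auto simp: length_Suc_conv gr0_conv_Suc)
  from total_computable_compose3[where f = "\<lambda>a x y. if a = 0 then x else y", OF this] assms
  show ?thesis by simp
qed

section \<open>Arithmetic and the Cantor pairing function\<close>

lemma total_computable_add: "total_computable 2 (\<lambda>xs. xs ! 0 + xs ! 1)"
proof -
  have "total_computable (Suc 1)
      (\<lambda>xs. rec_nat (tl xs ! 0) (\<lambda>m r. Suc ((m # r # tl xs) ! 1)) (xs ! 0))"
    by (intro total_computable_rec total_computable_proj
        compose_Suc) auto
  moreover have "rec_nat a (\<lambda>m r. Suc r) b = b + a" for a b by (induction b) auto
  ultimately show ?thesis
    unfolding numeral_2_eq_2 One_nat_def
    by (elim total_computable_cong) (auto simp: length_Suc_conv)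
qed

lemmas compose_add = total_computable_compose2[where f = "(+)", OF total_computable_add]

lemma total_computable_pred: "total_computable 1 (\<lambda>xs. xs ! 0 - 1)"
proof -
  have "total_computable (Suc 0) (\<lambda>xs. rec_nat 0 (\<lambda>m r. (m # r # tl xs) ! 0) (xs ! 0))"
    by (intro total_computable_rec total_computable_proj total_computable_const) auto
  moreover have "rec_nat 0 (\<lambda>m r. m) b = b - 1" for b :: nat by (cases b) auto
  ultimately show ?thesis by simp
qed

lemmas compose_pred = total_computable_compose1[where f = "\<lambda>x. x - 1", OF total_computable_pred]

lemma total_computable_diff: "total_computable 2 (\<lambda>xs. xs ! 0 - xs ! 1)"
proof -
  have "total_computable (Suc 1)
      (\<lambda>xs. rec_nat (tl xs ! 0) (\<lambda>m r. (m # r # tl xs) ! 1 - 1) (xs ! 0))"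
    by (intro total_computable_rec total_computable_proj
        compose_pred) auto
  moreover have "rec_nat a (\<lambda>m r. r - Suc 0) b = a - b" for a b :: nat by (induction b) auto
  \<comment> \<open>The recursion runs on the subtrahend, which therefore comes first; the swap is
    undone below.\<close>
  ultimately have "total_computable 2 (\<lambda>xs. xs ! 1 - xs ! 0)"
    unfolding numeral_2_eq_2 One_nat_def
    by (elim total_computable_cong) (auto simp: length_Suc_conv)
  from total_computable_compose2[where f = "\<lambda>a b. b - a", OF this,
      where g = "\<lambda>xs. xs ! 1" and h = "\<lambda>xs. xs ! 0"]
  show ?thesis by (simp add: total_computable_proj)
qed

lemmas compose_diff = total_computable_compose2[where f = "(-)", OF total_computable_diff]

lemma total_computable_triangle: "total_computable 1 (\<lambda>xs. triangle (xs ! 0))"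
proof -
  have "total_computable (Suc 0)
      (\<lambda>xs. rec_nat 0 (\<lambda>m r. (m # r # tl xs) ! 1 + Suc ((m # r # tl xs) ! 0)) (xs ! 0))"
    by (intro total_computable_rec total_computable_proj total_computable_const
        compose_Suc
        compose_add) auto
  moreover have "rec_nat 0 (\<lambda>m r. Suc (r + m)) b = triangle b" for b by (induction b) auto
  ultimately show ?thesis by simp
qed

lemmas compose_triangle = total_computable_compose1[where f = triangle, OF total_computable_triangle]

lemma total_computable_prod_encode: "total_computable 2 (\<lambda>xs. prod_encode (xs ! 0, xs ! 1))"
  unfolding prod_encode_def prod.case
  by (intro total_computable_proj compose_add
      compose_triangle) auto

lemmas compose_prod_encode = total_computable_compose2[where f = "\<lambda>x y. prod_encode (x, y)",
    OF total_computable_prod_encode]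

abbreviation pfst :: "nat \<Rightarrow> nat" where "pfst z \<equiv> fst (prod_decode z)"
abbreviation psnd :: "nat \<Rightarrow> nat" where "psnd z \<equiv> snd (prod_decode z)"

lemma triangle_mono: "m \<le> n \<Longrightarrow> triangle m \<le> triangle n"
  by (induction rule: dec_induct) auto

text \<open>Pairs with sum \<open>w\<close> have codes from \<open>triangle w\<close> up to just
  below \<open>triangle (Suc w)\<close>, so a minimisation finds the diagonal of \<open>z\<close>,
  and decoding follows by subtraction.\<close>

lemma Least_triangle: "(LEAST w. Suc z - triangle (Suc w) = 0) = pfst z + psnd z"
proof -
  obtain a b where z: "z = prod_encode (a, b)"
    by (metis prod_decode_inverse surj_pair)
  have "a + b \<le> w" if "Suc z - triangle (Suc w) = 0" for w
  proof (rule ccontr)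
    assume "\<not> ?thesis"
    then have "triangle (Suc w) \<le> triangle (a + b)" by (intro triangle_mono) auto
    then show False using that z by (simp add: prod_encode_def)
  qed
  then have "(LEAST w. Suc z - triangle (Suc w) = 0) = a + b"
    by (intro Least_equality) (auto simp: z prod_encode_def)
  then show ?thesis by (simp add: z)
qed

lemma total_computable_pfst_plus_psnd: "total_computable 1 (\<lambda>xs. pfst (xs ! 0) + psnd (xs ! 0))"
proof -
  have "total_computable 1 (\<lambda>xs. LEAST n. Suc ((n # xs) ! 1) - triangle (Suc ((n # xs) ! 0)) = 0)"
  proof (rule total_computable_Least)
    show "total_computable (Suc 1) (\<lambda>xs. Suc (xs ! 1) - triangle (Suc (xs ! 0)))"
      by (intro total_computable_proj compose_diff compose_Suc
          compose_triangle) auto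
    show "\<exists>n. Suc ((n # xs) ! 1) - triangle (Suc ((n # xs) ! 0)) = 0" for xs
      by (rule exI[of _ "xs ! 0"]) auto
  qed
  then show ?thesis
    by (simp only: nth_Cons_0 nth_Cons_Suc One_nat_def Least_triangle)
qed

lemma total_computable_pfst: "total_computable 1 (\<lambda>xs. pfst (xs ! 0))"
proof -
  have *: "z - triangle (pfst z + psnd z) = pfst z" for z
    using prod_decode_inverse[of z] by (cases "prod_decode z") (auto simp: prod_encode_def)
  have "total_computable 1 (\<lambda>xs. xs ! 0 - triangle (pfst (xs ! 0) + psnd (xs ! 0)))"
    by (intro total_computable_proj compose_diff compose_triangle total_computable_pfst_plus_psnd) auto
  then show ?thesis by (simp add: *)
qed

lemmas compose_pfst = total_computable_compose1[where f = pfst, OF total_computable_pfst]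

lemma total_computable_psnd: "total_computable 1 (\<lambda>xs. psnd (xs ! 0))"
proof -
  have "total_computable 1 (\<lambda>xs. pfst (xs ! 0) + psnd (xs ! 0) - pfst (xs ! 0))"
    by (rule compose_diff)
      (intro total_computable_pfst_plus_psnd total_computable_pfst)+
  then show ?thesis by simp
qed

lemmas compose_psnd = total_computable_compose1[where f = psnd, OF total_computable_psnd]

section \<open>Unary computable functions, with several arguments packed by pairing\<close>

definition computable :: "(nat \<Rightarrow> nat) \<Rightarrow> bool" where
  "computable f \<longleftrightarrow> total_computable 1 (\<lambda>xs. f (xs ! 0))"

lemma computable_id: "computable (\<lambda>x. x)"
  unfolding computable_def by (intro total_computable_proj) auto

lemma computable_const: "computable (\<lambda>x. c)"
  unfolding computable_def by (rule total_computable_const)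

lemma computable_Suc: "computable f \<Longrightarrow> computable (\<lambda>x. Suc (f x))"
  unfolding computable_def
  by (intro compose_Suc) auto

lemma computable_pred: "computable f \<Longrightarrow> computable (\<lambda>x. f x - 1)"
  unfolding computable_def
  by (intro compose_pred) auto

lemma computable_prod_encode:
  "computable f \<Longrightarrow> computable g \<Longrightarrow> computable (\<lambda>x. prod_encode (f x, g x))"
  unfolding computable_def
  by (intro compose_prod_encode)

lemma computable_pfst: "computable f \<Longrightarrow> computable (\<lambda>x. pfst (f x))"
  unfolding computable_def
  by (intro compose_pfst) auto

lemma computable_psnd: "computable f \<Longrightarrow> computable (\<lambda>x. psnd (f x))"
  unfolding computable_def
  by (intro compose_psnd) auto

lemma computable_less:
  "computable f \<Longrightarrow> computable g \<Longrightarrow> computable h \<Longrightarrow> computable i \<Longrightarrow>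
   computable (\<lambda>x. if f x < g x then h x else i x)"
proof -
  have *: "(if f x < g x then h x else i x) = (if Suc (f x) - g x = 0 then h x else i x)" for x
    by auto
  show "computable f \<Longrightarrow> computable g \<Longrightarrow> computable h \<Longrightarrow> computable i \<Longrightarrow> ?thesis"
    unfolding computable_def *
    by (intro total_computable_If compose_diff
        compose_Suc) auto
qed

lemma computable_eq:
  "computable f \<Longrightarrow> computable g \<Longrightarrow> computable h \<Longrightarrow> computable i \<Longrightarrow>
   computable (\<lambda>x. if f x = g x then h x else i x)"
proof -
  have *: "(if f x = g x then h x else i x) =
      (if f x < g x then i x else if g x < f x then i x else h x)" for x
    by auto
  show "computable f \<Longrightarrow> computable g \<Longrightarrow> computable h \<Longrightarrow> computable i \<Longrightarrow> ?thesis"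
    unfolding * by (intro computable_less)
qed

lemma computable_compose: "computable f \<Longrightarrow> computable g \<Longrightarrow> computable (\<lambda>x. f (g x))"
  unfolding computable_def by (rule total_computable_compose1)

text \<open>Iteration with a parameter is the form of all later recursions: \<open>bound\<close>,
  \<open>probe\<close>, machine runs and \<open>drop_step\<close>.\<close>

lemma computable_funpow:
  assumes G: "computable (\<lambda>z. G (pfst z) (psnd z))" and "computable a" "computable k" "computable b"
  shows "computable (\<lambda>x. (G (a x) ^^ k x) (b x))"
proof -
  have "total_computable 2 (\<lambda>xs. G (xs ! 0) (xs ! 1))"
    using total_computable_compose1[OF G[unfolded computable_def] total_computable_prod_encode] by simp
  from total_computable_compose2[OF this, of 4 "\<lambda>xs. xs ! 3" "\<lambda>xs. xs ! 1"]
  have "total_computable (Suc (Suc 2)) (\<lambda>xs. G (xs ! 3) (xs ! 1))"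
    by (simp add: total_computable_proj)
  then have "total_computable (Suc 2)
      (\<lambda>xs. rec_nat (tl xs ! 0) (\<lambda>m r. G ((m # r # tl xs) ! 3) ((m # r # tl xs) ! 1)) (xs ! 0))"
    by (intro total_computable_rec total_computable_proj) auto
  moreover have "rec_nat x (\<lambda>m r. G y r) n = (G y ^^ n) x" for x y n by (induction n) auto
  ultimately have "total_computable 3 (\<lambda>xs. (G (xs ! 2) ^^ (xs ! 0)) (xs ! 1))"
    unfolding numeral_3_eq_3 numeral_2_eq_2
    by (elim total_computable_cong) (auto simp: length_Suc_conv)
  from total_computable_compose3[where f = "\<lambda>n x y. (G y ^^ n) x", OF this] assms(2-)
  show ?thesis unfolding computable_def by simp
qed

lemmas computable_intros = computable_id computable_const computable_Suc computable_pred
  computable_prod_encode computable_pfst computable_psnd computable_less computable_eq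

lemma computable_recf:
  assumes "computable f"
  obtains e where "oracle_free e" "\<And>A x. ev A e [x] (f x) []"
proof -
  from assms obtain e where e: "oracle_free e"
    "\<forall>A xs. length xs = 1 \<longrightarrow> ev A e xs (f (xs ! 0)) []"
    unfolding computable_def total_computable_def by blast
  have "ev A e [x] (f x) []" for A x using e(2)[rule_format, of "[x]" A] by simp
  with e(1) that show thesis by blast
qed

text \<open>A set given by a decidable witness relation is the domain of the search for a witness,
  as \<open>indexed_family\<close> demands.\<close>

lemma indexed_familyI:
  assumes "computable G" "\<And>n x. x \<in> F n \<longleftrightarrow> (\<exists>k. G (prod_encode (k, prod_encode (n, x))) = 0)"
  shows "indexed_family F"
proof -
  have "total_computable 3 (\<lambda>xs. prod_encode (xs ! 0, prod_encode (xs ! 1, xs ! 2)))"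
    by (intro compose_prod_encode total_computable_proj) auto
  from total_computable_compose1[OF assms(1)[unfolded computable_def] this]
  obtain e where e: "oracle_free e"
    "\<forall>A xs. length xs = 3 \<longrightarrow> ev A e xs (G (prod_encode (xs ! 0, prod_encode (xs ! 1, xs ! 2)))) []"
    unfolding total_computable_def by auto
  have ev: "ev A e [k, n, x] (G (prod_encode (k, prod_encode (n, x)))) []" for A k n x
    using e(2)[rule_format, of "[k, n, x]" A] by (simp add: numeral_2_eq_2)
  have "(\<exists>k. G (prod_encode (k, prod_encode (n, x))) = 0) \<longleftrightarrow> (\<exists>y q. ev {} (Mu e) [n, x] y q)" for n x
  proof
    assume "\<exists>k. G (prod_encode (k, prod_encode (n, x))) = 0"
    from ev_Mu_Least[OF ev this] show "\<exists>y q. ev {} (Mu e) [n, x] y q" by blast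
  next
    assume "\<exists>y q. ev {} (Mu e) [n, x] y q"
    then obtain y q where "evmu {} e [n, x] 0 y q" by (auto elim: ev_MuE)
    from evmu_zero(3)[OF this] obtain q' where "ev {} e [y, n, x] 0 q'" by blast
    from ev_deterministic(1)[OF this ev]
    show "\<exists>k. G (prod_encode (k, prod_encode (n, x))) = 0" by blast
  qed
  with e(1) assms(2) show ?thesis
    unfolding indexed_family_def by (intro exI[of _ "Mu e"]) auto
qed

section \<open>A universal machine\<close>

text \<open>These mirror \<open>list_encode\<close>, with 0 for the empty list, and serve for
  argument lists and task stacks alike.\<close>

abbreviation lcons :: "nat \<Rightarrow> nat \<Rightarrow> nat" where "lcons a c \<equiv> Suc (prod_encode (a, c))"
abbreviation lhd :: "nat \<Rightarrow> nat" where "lhd c \<equiv> pfst (c - 1)"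
abbreviation ltl :: "nat \<Rightarrow> nat" where "ltl c \<equiv> psnd (c - 1)"

text \<open>The empty argument list shares its code with \<open>Zero\<close>: both must leave 0 in
  the register, and 0 is also the code of the empty list.\<close>

fun encode :: "recf \<Rightarrow> nat" and encode_list :: "recf list \<Rightarrow> nat" where
  "encode Zero = prod_encode (0, 0)"
| "encode Succ = prod_encode (1, 0)"
| "encode (Proj i) = prod_encode (2, i)"
| "encode Oracle = prod_encode (3, 0)"
| "encode (Comp f gs) = prod_encode (4, prod_encode (encode f, encode_list gs))"
| "encode (PrimRec f g) = prod_encode (5, prod_encode (encode f, encode g))"
| "encode (Mu f) = prod_encode (6, encode f)"
| "encode_list [] = prod_encode (0, 0)"
| "encode_list (g # gs) = prod_encode (7, prod_encode (encode g, encode_list gs))"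

text \<open>A state is a pair of a register and a stack of tasks. A task is either the code of a program,
  which replaces the argument list in the register by the value of the program, or a continuation
  (tags 8 to 11) left behind by primitive recursion, minimisation, or the evaluation of an
  argument list. Queries are answered according to the oracle set of all \<open>prod_encode (n, x)\<close>.\<close>

definition step :: "nat \<Rightarrow> nat \<Rightarrow> nat" where
  "step n s = (let v = pfst s; k = psnd s; t = lhd k; r = ltl k; a = psnd t in
     if k = 0 then s
     else if pfst t = 0 then prod_encode (0, r)
     else if pfst t = 1 then prod_encode (Suc (lhd v), r)
     else if pfst t = 2 then
       (if a = 0 then prod_encode (lhd v, r)
        else prod_encode (ltl v, lcons (prod_encode (2, a - 1)) r))
     else if pfst t = 3 then prod_encode (if pfst (lhd v) = n then 1 else 0, r)
     else if pfst t = 4 then prod_encode (v, lcons (psnd a) (lcons (pfst a) r))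
     else if pfst t = 5 then
       (if lhd v = 0 then prod_encode (ltl v, lcons (pfst a) r)
        else prod_encode (lcons (lhd v - 1) (ltl v),
          lcons t (lcons (prod_encode (8,
            prod_encode (psnd a, prod_encode (lhd v - 1, ltl v)))) r)))
     else if pfst t = 6 then
       prod_encode (lcons 0 v,
         lcons a (lcons (prod_encode (9, prod_encode (a, prod_encode (0, v)))) r))
     else if pfst t = 7 then
       prod_encode (v, lcons (pfst a) (lcons (prod_encode (10, prod_encode (psnd a, v))) r))
     else if pfst t = 8 then
       prod_encode (lcons (pfst (psnd a)) (lcons v (psnd (psnd a))), lcons (pfst a) r)
     else if pfst t = 9 then
       (if v = 0 then prod_encode (pfst (psnd a), r)
        else prod_encode (lcons (Suc (pfst (psnd a))) (psnd (psnd a)),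
          lcons (pfst a) (lcons (prod_encode (9,
            prod_encode (pfst a, prod_encode (Suc (pfst (psnd a)), psnd (psnd a))))) r)))
     else if pfst t = 10 then
       prod_encode (psnd a, lcons (pfst a) (lcons (prod_encode (11, v)) r))
     else prod_encode (lcons a v, r))"

lemma computable_step: "computable (\<lambda>z. step (pfst z) (psnd z))"
  unfolding step_def Let_def by (intro computable_intros)

text \<open>Halted states are fixed points, so results of runs of different lengths can be compared
  at a common later time.\<close>

lemma step_final: "step n (prod_encode (v, 0)) = prod_encode (v, 0)"
  by (simp add: step_def Let_def)

lemma step_final_funpow: "(step n ^^ k) (prod_encode (v, 0)) = prod_encode (v, 0)"
  by (induction k) (auto simp: step_final)

definition reaches :: "nat \<Rightarrow> nat \<Rightarrow> nat \<Rightarrow> bool" where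
  "reaches n s s' \<longleftrightarrow> (\<exists>k. (step n ^^ k) s = s')"

lemma reaches_refl: "reaches n s s"
  unfolding reaches_def by (rule exI[of _ 0]) simp

lemma reaches_step: "reaches n (step n s) s' \<Longrightarrow> reaches n s s'"
  unfolding reaches_def by (metis comp_apply funpow_Suc_right)

lemma reaches_trans: "reaches n s s' \<Longrightarrow> reaches n s' s'' \<Longrightarrow> reaches n s s''"
  unfolding reaches_def by (metis comp_apply funpow_add)

text \<open>The target on which learner number \<open>n\<close> is refuted, and the oracle set built
  into \<open>step n\<close>.\<close>

definition column :: "nat \<Rightarrow> nat set" where
  "column n = {z. pfst z = n}"

text \<open>Induction on the derivation for an arbitrary rest \<open>K\<close> of the stack, so that
  subcomputations can run on top of pending continuations. In the third part the loop is under way,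
  its counter and arguments stored in the task with tag 9.\<close>

lemma reaches_ev:
  "ev A f xs y q \<Longrightarrow> A = column n \<Longrightarrow>
     reaches n (prod_encode (list_encode xs, lcons (encode f) K)) (prod_encode (y, K))"
  "evs A gs xs ys q \<Longrightarrow> A = column n \<Longrightarrow>
     reaches n (prod_encode (list_encode xs, lcons (encode_list gs) K))
       (prod_encode (list_encode ys, K))"
  "evmu A f xs m y q \<Longrightarrow> A = column n \<Longrightarrow>
     reaches n (prod_encode (list_encode (m # xs),
         lcons (encode f) (lcons (prod_encode (9,
           prod_encode (encode f, prod_encode (m, list_encode xs)))) K)))
       (prod_encode (y, K))"
proof (induction arbitrary: K and K and K rule: ev_evs_evmu.inducts)
  case (ev_zero xs)
  show ?case by (rule reaches_step) (simp add: step_def Let_def reaches_refl)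
next
  case (ev_succ x xs)
  show ?case by (rule reaches_step) (simp add: step_def Let_def reaches_refl)
next
  case (ev_proj i xs)
  then show ?case
  proof (induction i arbitrary: xs)
    case 0
    then obtain x ys where xs: "xs = x # ys" by (cases xs) auto
    show ?case by (rule reaches_step) (simp add: step_def Let_def xs reaches_refl)
  next
    case (Suc i)
    then obtain x ys where xs: "xs = x # ys" by (cases xs) auto
    show ?case
      by (rule reaches_step) (use Suc.IH[of ys] Suc.prems in \<open>simp add: step_def Let_def xs\<close>)
  qed
next
  case (ev_oracle x xs)
  show ?case by (rule reaches_step) (use ev_oracle.prems in \<open>simp add: step_def Let_def reaches_refl column_def\<close>)
next
  case (ev_comp gs xs ys qs f y q)
  show ?case
    by (rule reaches_step)
      (use reaches_trans[OF ev_comp.IH(2)[OF ev_comp.prems] ev_comp.IH(4)[OF ev_comp.prems]]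
        in \<open>simp add: step_def Let_def\<close>)
next
  case (ev_prim0 f xs y q g)
  show ?case
    by (rule reaches_step) (use ev_prim0.IH(2)[OF ev_prim0.prems] in \<open>simp add: step_def Let_def\<close>)
next
  case (ev_primS f g m xs r q y q')
  have "reaches n (prod_encode (list_encode (Suc m # xs), lcons (encode (PrimRec f g)) K))
    (prod_encode (r, lcons (prod_encode (8, prod_encode (encode g,
       prod_encode (m, list_encode xs)))) K))"
    by (rule reaches_step) (use ev_primS.IH(2)[OF ev_primS.prems] in \<open>simp add: step_def Let_def\<close>)
  moreover have "reaches n (prod_encode (r, lcons (prod_encode (8, prod_encode (encode g,
       prod_encode (m, list_encode xs)))) K)) (prod_encode (y, K))"
    by (rule reaches_step) (use ev_primS.IH(4)[OF ev_primS.prems] in \<open>simp add: step_def Let_def\<close>)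
  ultimately show ?case by (rule reaches_trans)
next
  case (ev_mu f xs y q)
  show ?case
    by (rule reaches_step) (use ev_mu.IH(2)[OF ev_mu.prems] in \<open>simp add: step_def Let_def\<close>)
next
  case (evs_nil xs)
  show ?case by (rule reaches_step) (simp add: step_def Let_def reaches_refl)
next
  case (evs_cons g xs y q gs ys qs)
  have "reaches n (prod_encode (list_encode xs, lcons (encode_list (g # gs)) K))
    (prod_encode (y, lcons (prod_encode (10, prod_encode (encode_list gs, list_encode xs))) K))"
    by (rule reaches_step) (use evs_cons.IH(2)[OF evs_cons.prems] in \<open>simp add: step_def Let_def\<close>)
  moreover have "reaches n
    (prod_encode (y, lcons (prod_encode (10, prod_encode (encode_list gs, list_encode xs))) K))
    (prod_encode (list_encode ys, lcons (prod_encode (11, y)) K))"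
    by (rule reaches_step) (use evs_cons.IH(4)[OF evs_cons.prems] in \<open>simp add: step_def Let_def\<close>)
  moreover have "reaches n (prod_encode (list_encode ys, lcons (prod_encode (11, y)) K))
    (prod_encode (list_encode (y # ys), K))"
    by (rule reaches_step) (simp add: step_def Let_def reaches_refl)
  ultimately show ?case using reaches_trans by blast
next
  case (evmu_found f m xs q)
  have "reaches n (prod_encode (0, lcons (prod_encode (9, prod_encode (encode f,
      prod_encode (m, list_encode xs)))) K)) (prod_encode (m, K))"
    by (rule reaches_step) (simp add: step_def Let_def reaches_refl)
  with evmu_found.IH(2)[OF evmu_found.prems] show ?case using reaches_trans by blast
next
  case (evmu_next f m xs k q y q')
  have "reaches n (prod_encode (Suc k, lcons (prod_encode (9, prod_encode (encode f,
      prod_encode (m, list_encode xs)))) K)) (prod_encode (y, K))"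
    by (rule reaches_step) (use evmu_next.IH(4)[OF evmu_next.prems] in \<open>simp add: step_def Let_def\<close>)
  with evmu_next.IH(2)[OF evmu_next.prems] show ?case using reaches_trans by blast
qed

section \<open>The diagonal family\<close>

text \<open>\<open>prod_encode (x, x)\<close> is quadratic in \<open>x\<close>, so enough iterations
  dominate any polynomial; \<open>psnd n\<close> sets their number. The start involves
  \<open>prod_encode (n, 1)\<close> because this bounds the least index of
  \<open>column n\<close>.\<close>

definition bound :: "nat \<Rightarrow> nat" where
  "bound n = ((\<lambda>x. prod_encode (x, x)) ^^ psnd n) (prod_encode (n, 1) + 2)"

text \<open>The descending order arises because the code of the list is computed by repeated
  consing.\<close>

definition probe :: "nat \<Rightarrow> nat list" where
  "probe n = rev (map (\<lambda>k. prod_encode (n, k)) [0..<bound n])"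

definition initial :: "nat \<Rightarrow> nat" where
  "initial n = prod_encode (list_encode [list_encode (probe n)], lcons (pfst n) 0)"

text \<open>In \<open>diag_family\<close> the index \<open>prod_encode (n, b)\<close> plays the role of a pair of competing
  hypotheses for \<open>column n\<close>, one for \<open>b = 0\<close> and one for \<open>b \<noteq> 0\<close>. If learner number \<open>n\<close>, run on
  \<open>probe n\<close> with oracle \<open>column n\<close>, answers with an index \<open>b \<noteq> 0\<close>, then a halting time of
  this run is missing from the hypothesis with \<open>b \<noteq> 0\<close>; otherwise the one with \<open>b = 0\<close> is empty.\<close>

definition cert :: "nat \<Rightarrow> nat \<Rightarrow> bool" where
  "cert n k \<longleftrightarrow> psnd ((step n ^^ k) (initial n)) = 0 \<and> psnd (pfst ((step n ^^ k) (initial n))) \<noteq> 0"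

definition diag_family :: "nat \<Rightarrow> nat set" where
  "diag_family i = (if psnd i = 0 then {z. pfst z = pfst i \<and> (\<exists>k. cert (pfst i) k)}
     else {z. pfst z = pfst i \<and> \<not> cert (pfst i) (psnd z)})"

lemma computable_bound: "computable bound"
proof -
  have "computable (\<lambda>n. ((\<lambda>u x. prod_encode (x, x)) 0 ^^ psnd n) (Suc (Suc (prod_encode (n, 1)))))"
    by (rule computable_funpow[where G = "\<lambda>u x. prod_encode (x, x)" and a = "\<lambda>_. 0"])
      (intro computable_intros)+
  then show ?thesis by (simp add: bound_def[abs_def])
qed

lemma probe_funpow:
  "((\<lambda>n s. prod_encode (Suc (pfst s), lcons (prod_encode (n, pfst s)) (psnd s))) n ^^ k)
     (prod_encode (0, 0)) = prod_encode (k, list_encode (rev (map (\<lambda>k. prod_encode (n, k)) [0..<k])))"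
  by (induction k) auto

lemma computable_probe: "computable (\<lambda>n. list_encode (probe n))"
proof -
  have "computable (\<lambda>n. psnd (((\<lambda>n s. prod_encode (Suc (pfst s),
      lcons (prod_encode (n, pfst s)) (psnd s))) n ^^ bound n) (prod_encode (0, 0))))"
    by (intro computable_psnd computable_funpow computable_bound) (intro computable_intros)+
  then show ?thesis unfolding probe_funpow by (simp add: probe_def)
qed

lemma computable_initial: "computable initial"
  unfolding initial_def[abs_def] list_encode.simps
  by (intro computable_intros computable_probe)

text \<open>A certificate is checked by running the machine for a given number of steps, so checking
  is total although finding one is an unbounded search.\<close>

lemma computable_cert:
  assumes "computable f" "computable g" "computable h" "computable i"
  shows "computable (\<lambda>x. if cert (f x) (g x) then h x else i x)"
proof -
  have state: "computable (\<lambda>x. (step (f x) ^^ g x) (initial (f x)))"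
    by (intro computable_funpow computable_step computable_compose[OF computable_initial] assms)
  have *: "(if cert (f x) (g x) then h x else i x) =
     (if psnd ((step (f x) ^^ g x) (initial (f x))) = 0 then
       if psnd (pfst ((step (f x) ^^ g x) (initial (f x)))) = 0 then i x else h x else i x)" for x
    by (simp add: cert_def)
  show ?thesis unfolding * by (intro computable_intros state assms)
qed

lemma indexed_family_diag: "indexed_family diag_family"
proof (rule indexed_familyI)
  let ?i = "\<lambda>u. pfst (psnd u)" and ?z = "\<lambda>u. psnd (psnd u)"
  \<comment> \<open>With second component 0 the search runs through possible certificates; the other
    sets are decidable outright.\<close>
  show "computable (\<lambda>u. if pfst (?z u) = pfst (?i u) then
      if psnd (?i u) = 0 then if cert (pfst (?i u)) (pfst u) then 0 else 1
      else if cert (pfst (?i u)) (psnd (?z u)) then 1 else 0 else 1)"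
    by (intro computable_intros computable_cert)
qed (auto simp: diag_family_def)

section \<open>Domination of polynomials by iterated pairing\<close>

lemma prod_encode_diag: "prod_encode (x, x) = x * (2 * x + 2)"
proof -
  have "triangle (x + x) = x * (2 * x + 1)"
    by (induction x) auto
  then show ?thesis by (simp add: prod_encode_def)
qed

lemma funpow_prod_encode_ge:
  "y > 0 \<Longrightarrow> y + a \<le> ((\<lambda>x. prod_encode (x, x)) ^^ a) y"
proof (induction a)
  case (Suc a)
  define z where "z = ((\<lambda>x. prod_encode (x, x)) ^^ a) y"
  have "z > 0" using Suc by (simp add: z_def)
  then have "z + 1 \<le> z * (2 * z + 2)" by (cases z) auto
  then show ?case using Suc by (simp add: prod_encode_diag flip: z_def)
qed simp

text \<open>Induction along Horner's scheme: one more iteration, being quadratic, absorbs the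
  multiplication by \<open>m\<close>, and \<open>a\<close> further ones absorb the constant term.
  Starting at \<open>m + 2\<close> keeps the iterates positive.\<close>

lemma poly_le_funpow:
  "\<exists>d. \<forall>m. poly p m \<le> ((\<lambda>x. prod_encode (x, x)) ^^ d) (m + 2)"
proof (induction p rule: pCons_induct)
  case (pCons a p)
  then obtain d where d: "\<And>m. poly p m \<le> ((\<lambda>x. prod_encode (x, x)) ^^ d) (m + 2)" by blast
  have "poly (pCons a p) m \<le> ((\<lambda>x. prod_encode (x, x)) ^^ (a + Suc d)) (m + 2)" for m
  proof -
    define Y where "Y = ((\<lambda>x. prod_encode (x, x)) ^^ d) (m + 2)"
    have Y: "m + 2 \<le> Y" using funpow_prod_encode_ge[of "m + 2" d] by (simp add: Y_def)
    have "m * poly p m \<le> Y * (2 * Y + 2)"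
      using Y d[of m, folded Y_def] by (intro mult_mono) auto
    moreover have "prod_encode (Y, Y) > 0" using Y by (simp add: prod_encode_diag)
    from funpow_prod_encode_ge[OF this, of a]
    have "prod_encode (Y, Y) + a \<le> ((\<lambda>x. prod_encode (x, x)) ^^ (a + Suc d)) (m + 2)"
      unfolding funpow_add comp_apply funpow.simps Y_def .
    ultimately show ?thesis by (simp add: prod_encode_diag)
  qed
  then show ?case by blast
qed simp

lemma poly_nat_mono: "x \<le> y \<Longrightarrow> poly p x \<le> poly p y" for p :: "nat poly"
  by (induction p) (auto intro: add_mono mult_mono)

section \<open>Failure of all learners with an oracle on the diagonal family\<close>

definition probe_enum :: "nat \<Rightarrow> nat \<Rightarrow> nat" where
  "probe_enum n k = prod_encode (n, if k < bound n then bound n - Suc k else k)"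

text \<open>Injectivity equates the content size with the number of data seen. The reversal of the
  first \<open>bound n\<close> positions matches the descending \<open>probe n\<close>.\<close>

lemma probe_enum:
  "inj (probe_enum n)" "range (probe_enum n) = column n" "restr (probe_enum n) (bound n) = probe n"
proof -
  show "inj (probe_enum n)"
    by (rule injI) (auto simp: probe_enum_def split: if_splits)
  show "restr (probe_enum n) (bound n) = probe n"
    by (rule nth_equalityI) (auto simp: restr_def probe_def probe_enum_def rev_nth)
  have "z \<in> range (probe_enum n)" if "pfst z = n" for z
  proof -
    have z: "z = prod_encode (n, psnd z)"
      using that by (metis prod.collapse prod_decode_inverse)
    show ?thesis
    proof (cases "psnd z < bound n")
      case True
      then have "z = probe_enum n (bound n - Suc (psnd z))"
        by (subst z) (simp add: probe_enum_def)
      then show ?thesis by blast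
    next
      case False
      then have "z = probe_enum n (psnd z)"
        by (subst z) (simp add: probe_enum_def)
      then show ?thesis by blast
    qed
  qed
  then show "range (probe_enum n) = column n"
    by (auto simp: column_def probe_enum_def)
qed

lemma data_identity: "data A M (\<lambda>\<sigma> H. \<sigma>) f n = restr f n"
  by (simp add: data_def)

text \<open>The simulated run halts after \<open>t\<close> steps, a certified one after
  \<open>k\<close>. Both results persist to step \<open>t + k\<close>, hence agree.\<close>

lemma cert_iff_final:
  assumes "ev (column n) M [list_encode (probe n)] r q" "pfst n = encode M"
  shows "(\<exists>k. cert n k) \<longleftrightarrow> psnd r \<noteq> 0"
proof -
  from reaches_ev(1)[OF assms(1) refl, of 0] obtain t
    where t: "(step n ^^ t) (initial n) = prod_encode (r, 0)"
    by (auto simp: reaches_def initial_def assms(2))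
  have "psnd r \<noteq> 0" if "cert n k" for k
  proof -
    from that have "(step n ^^ k) (initial n) = prod_encode (pfst ((step n ^^ k) (initial n)), 0)"
      unfolding cert_def by (metis prod.collapse prod_decode_inverse)
    then have "(step n ^^ (t + k)) (initial n) = prod_encode (pfst ((step n ^^ k) (initial n)), 0)"
      by (metis comp_apply funpow_add step_final_funpow)
    moreover have "(step n ^^ (t + k)) (initial n) = prod_encode (r, 0)"
      by (metis add.commute comp_apply funpow_add step_final_funpow t)
    ultimately have "pfst ((step n ^^ k) (initial n)) = r" by simp
    with that show ?thesis by (simp add: cert_def)
  qed
  moreover have "cert n t" if "psnd r \<noteq> 0"
    using that t by (simp add: cert_def)
  ultimately show ?thesis by blast
qed

lemma diag_family_not_PSD_O: "diag_family \<notin> PSD_O"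
proof
  assume "diag_family \<in> PSD_O"
  then obtain M p where crit: "psd_crit diag_family M (\<lambda>\<sigma> H. \<sigma>) p"
    by (auto simp: PSD_O_def)
  obtain d where d: "\<And>m. poly p m \<le> ((\<lambda>x. prod_encode (x, x)) ^^ d) (m + 2)"
    using poly_le_funpow by blast
  \<comment> \<open>\<open>n\<close> stores the learner together with the number of iterations that
    dominates its polynomial.\<close>
  define n where "n = prod_encode (encode M, d)"
  \<comment> \<open>However the simulated run ends, one of the two hypotheses is the full
    column.\<close>
  have "\<exists>i \<le> prod_encode (n, 1). diag_family i = column n"
  proof (cases "\<exists>k. cert n k")
    case True
    then have "diag_family (prod_encode (n, 0)) = column n"
      by (auto simp: diag_family_def column_def)
    moreover have "prod_encode (n, 0) \<le> prod_encode (n, 1)" by (simp add: prod_encode_def)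
    ultimately show ?thesis by blast
  next
    case False
    then show ?thesis
      by (intro exI[of _ "prod_encode (n, 1)"]) (auto simp: diag_family_def column_def)
  qed
  then obtain i where i: "i \<le> prod_encode (n, 1)" "diag_family i = column n" by blast
  have "mi diag_family (column n) \<le> prod_encode (n, 1)"
    unfolding mi_def using Least_le[of "\<lambda>k. diag_family k = column n" i] i by simp
  then have le_bound: "poly p (mi diag_family (column n)) \<le> bound n"
    using order_trans[OF poly_nat_mono d] by (simp add: bound_def n_def)
  have enum: "enumeration (probe_enum n) (diag_family i)"
    using probe_enum(2)[of n] by (auto simp: enumeration_def i(2))
  then obtain k where k: "card (set (restr (probe_enum n) k)) < poly p (mi diag_family (column n))"
    "\<forall>j\<ge>k. conv (column n) M (restr (probe_enum n) j) \<and>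
       res (column n) M (restr (probe_enum n) j) = res (column n) M (restr (probe_enum n) k)"
    "diag_family (res (column n) M (restr (probe_enum n) k)) = column n"
    using crit[unfolded psd_crit_def data_identity, rule_format, OF enum, unfolded i(2)] by blast
  have "card (set (restr (probe_enum n) k)) = k"
    using probe_enum(1)[of n] by (simp add: restr_def card_image inj_on_subset)
  with k(1) le_bound have "k \<le> bound n" by simp
  define r where "r = res (column n) M (probe n)"
  \<comment> \<open>The learner has settled by position \<open>bound n\<close>, so its answer on
    \<open>probe n\<close> is already the final, correct one.\<close>
  note k(2)[rule_format, OF \<open>k \<le> bound n\<close>, unfolded probe_enum(3)]
  with k(3) have "conv (column n) M (probe n)" and r: "diag_family r = column n"
    by (simp_all add: r_def)
  then obtain q where "ev (column n) M [list_encode (probe n)] r q"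
    unfolding r_def using ev_res by blast
  from cert_iff_final[OF this] have cert: "(\<exists>k. cert n k) \<longleftrightarrow> psnd r \<noteq> 0"
    by (simp add: n_def)
  have all: "prod_encode (n, x) \<in> diag_family r" for x
    by (simp add: r column_def)
  from all[of 0] have r_n: "pfst r = n" by (simp add: diag_family_def split: if_splits)
  \<comment> \<open>An answer with second component 0 leaves no certificate and denotes the empty
    set; any other answer creates a certificate that its own set omits.\<close>
  show False
  proof (cases "psnd r = 0")
    case True
    with all[of 0] cert show False by (simp add: diag_family_def r_n)
  next
    case False
    with cert obtain k where "cert n k" by blast
    with all[of k] False show False by (simp add: diag_family_def r_n)
  qed
qed

section \<open>Learning the diagonal family with a teacher\<close>

text \<open>The first entry reveals the column, the presence of a second one that a certificate has
  occurred. A certificate in first place is sent twice, so the length alone carries the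
  message.\<close>

definition diag_teacher :: "nat list \<Rightarrow> nat list" where
  "diag_teacher \<sigma> = take 1 \<sigma> @ take 1 (dropWhile (\<lambda>z. \<not> cert (pfst z) (psnd z)) \<sigma>)"

text \<open>One round of \<open>dropWhile\<close> on codes. It rests at the empty list or a
  certificate, so surplus iterations do no harm.\<close>

definition drop_step :: "nat \<Rightarrow> nat" where
  "drop_step c = (if c = 0 then 0 else if cert (pfst (lhd c)) (psnd (lhd c)) then c else ltl c)"

lemma drop_step_funpow:
  "length \<sigma> \<le> k \<Longrightarrow> (drop_step ^^ k) (list_encode \<sigma>) =
     list_encode (dropWhile (\<lambda>z. \<not> cert (pfst z) (psnd z)) \<sigma>)"
proof (induction \<sigma> arbitrary: k)
  case Nil
  have "(drop_step ^^ k) 0 = 0" by (induction k) (auto simp: drop_step_def)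
  then show ?case by simp
next
  case (Cons z \<sigma>)
  show ?case
  proof (cases "cert (pfst z) (psnd z)")
    case True
    then have "(drop_step ^^ k) (list_encode (z # \<sigma>)) = list_encode (z # \<sigma>)"
      by (induction k) (auto simp: drop_step_def)
    with True show ?thesis by simp
  next
    case False
    from Cons.prems obtain k' where k: "k = Suc k'" "length \<sigma> \<le> k'" by (cases k) auto
    have "drop_step (list_encode (z # \<sigma>)) = list_encode \<sigma>"
      using False by (simp add: drop_step_def)
    then have "(drop_step ^^ k) (list_encode (z # \<sigma>)) = (drop_step ^^ k') (list_encode \<sigma>)"
      by (simp only: k(1) funpow_Suc_right comp_apply)
    with Cons.IH[OF k(2)] False show ?thesis by simp
  qed
qed

lemma length_le_list_encode: "length \<sigma> \<le> list_encode \<sigma>"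
proof (induction \<sigma>)
  case (Cons x \<sigma>)
  then show ?case using le_prod_encode_2[of "list_encode \<sigma>" x] by simp
qed simp

lemma teacher_diag: "teacher diag_teacher"
proof -
  \<comment> \<open>The code of a list bounds its length and so serves as iteration count; 0 fills
    the parameter of \<open>computable_funpow\<close>.\<close>
  define D where "D c = ((\<lambda>u. drop_step) (0 :: nat) ^^ c) c" for c
  have D: "D (list_encode \<sigma>) = list_encode (dropWhile (\<lambda>z. \<not> cert (pfst z) (psnd z)) \<sigma>)" for \<sigma>
    unfolding D_def by (rule drop_step_funpow[OF length_le_list_encode])
  have "computable D"
    unfolding D_def[abs_def]
    by (rule computable_funpow[where G = "\<lambda>u. drop_step" and a = "\<lambda>_. 0"])
      (unfold drop_step_def, (intro computable_intros computable_cert)+)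
  then have "computable (\<lambda>c. if c = 0 then 0 else
      lcons (lhd c) (if D c = 0 then 0 else lcons (lhd (D c)) 0))"
    by (intro computable_intros) auto
  then obtain t where t: "oracle_free t" "\<And>A c. ev A t [c] (if c = 0 then 0 else
      lcons (lhd c) (if D c = 0 then 0 else lcons (lhd (D c)) 0)) []"
    by (rule computable_recf) blast
  have "ev {} t [list_encode \<sigma>] (list_encode (diag_teacher \<sigma>)) []" for \<sigma>
  proof (cases \<sigma>)
    case Nil
    with t(2)[of "{}" 0] show ?thesis by (simp add: diag_teacher_def)
  next
    case (Cons x \<rho>)
    have "list_encode (diag_teacher \<sigma>) = (if list_encode \<sigma> = 0 then 0 else
      lcons (lhd (list_encode \<sigma>))
        (if D (list_encode \<sigma>) = 0 then 0 else lcons (lhd (D (list_encode \<sigma>))) 0))"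
      unfolding D diag_teacher_def
      by (cases "dropWhile (\<lambda>z. \<not> cert (pfst z) (psnd z)) \<sigma>") (simp_all add: Cons)
    with t(2)[of "{}" "list_encode \<sigma>"] show ?thesis by simp
  qed
  \<comment> \<open>The output grows only with the first datum and the first certificate, and is
    frozen after the latter.\<close>
  moreover have "prefix (diag_teacher \<sigma>) (diag_teacher (\<sigma> @ \<rho>))" for \<sigma> \<rho>
  proof (cases \<sigma>)
    case Nil
    then show ?thesis by (simp add: diag_teacher_def)
  next
    case (Cons x \<sigma>')
    show ?thesis
    proof (cases "\<forall>z\<in>set \<sigma>. \<not> cert (pfst z) (psnd z)")
      case True
      then have "dropWhile (\<lambda>z. \<not> cert (pfst z) (psnd z)) \<sigma> = []" by simp
      then show ?thesis unfolding diag_teacher_def by (simp add: Cons)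
    next
      case False
      then obtain z where z: "z \<in> set \<sigma>" "cert (pfst z) (psnd z)" by blast
      then have "dropWhile (\<lambda>z. \<not> cert (pfst z) (psnd z)) (\<sigma> @ \<rho>) =
          dropWhile (\<lambda>z. \<not> cert (pfst z) (psnd z)) \<sigma> @ \<rho>"
        by (intro dropWhile_append1) auto
      moreover have "dropWhile (\<lambda>z. \<not> cert (pfst z) (psnd z)) \<sigma> \<noteq> []"
        using z by (auto simp: dropWhile_eq_Nil_conv)
      ultimately show ?thesis unfolding diag_teacher_def by (simp add: Cons)
    qed
  qed
  moreover have "set (diag_teacher \<sigma>) \<subseteq> set \<sigma>" for \<sigma>
    unfolding diag_teacher_def
    by (auto dest!: in_set_takeD intro: set_dropWhileD)
  ultimately show ?thesis
    using t(1) unfolding teacher_def prefix_def by blast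
qed

lemma hist_oracle_free:
  assumes "oracle_free M"
  shows "hist A M T f n = []"
proof (induction n)
  case (Suc n)
  have "queries A M \<sigma> = []" if "conv A M \<sigma>" for \<sigma>
    using that res_queries_eq(3) oracle_free_ev(1) assms unfolding conv_def by metis
  with Suc show ?case by (simp add: Let_def)
qed simp

lemma diag_family_PSD_T: "diag_family \<in> PSD_T"
proof -
  \<comment> \<open>A single entry means no certificate so far: guess second component 1, the set
    without certificates; otherwise guess 0.\<close>
  have "computable (\<lambda>c. prod_encode (pfst (lhd c), if ltl c = 0 then 1 else 0))"
    by (intro computable_intros)
  then obtain M where M: "oracle_free M"
    "\<And>A c. ev A M [c] (prod_encode (pfst (lhd c), if ltl c = 0 then 1 else 0)) []"
    by (rule computable_recf) blast
  have conv: "conv A M \<sigma>" for A \<sigma> using res_queries_eq(1)[OF M(2)] .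
  have res: "res A M (z # \<sigma>) = prod_encode (pfst z, if \<sigma> = [] then 1 else 0)" for A z \<sigma>
    using res_queries_eq(2)[OF M(2)[of A "list_encode (z # \<sigma>)"]] by (cases \<sigma>) auto
  \<comment> \<open>At most two elements are ever passed on and no queries are made, whence the
    constant 3.\<close>
  have "psd_crit diag_family M (\<lambda>\<sigma> H. diag_teacher \<sigma>) [:3:]"
    unfolding psd_crit_def data_def hist_oracle_free[OF M(1)]
  proof (intro allI impI)
    fix i f
    assume f: "enumeration f (diag_family i)"
    define n where "n = pfst i"
    have ran: "range f = diag_family i" using f by (simp add: enumeration_def)
    have fn: "pfst (f k) = n" for k
      using ran by (auto simp: n_def diag_family_def split: if_splits)
    have card: "card (set (diag_teacher \<sigma>)) < poly [:3:] m" for \<sigma> m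
    proof -
      have "length (diag_teacher \<sigma>) \<le> 2" by (simp add: diag_teacher_def)
      with card_length[of "diag_teacher \<sigma>"] show ?thesis by simp
    qed
    have restr: "restr f (Suc j) = f 0 # map f [1..<Suc j]" for j
      by (simp add: restr_def upt_rec)
    have "\<exists>k b. diag_family (prod_encode (n, b)) = diag_family i \<and>
      (\<forall>j\<ge>k. \<forall>A. res A M (diag_teacher (restr f j)) = prod_encode (n, b))"
    proof (cases "\<exists>k. cert n (psnd (f k))")
      case True
      then obtain k where k: "cert n (psnd (f k))" by blast
      have "f k \<in> diag_family i" using ran by blast
      then have "psnd i = 0"
        using k by (auto simp: diag_family_def n_def split: if_splits)
      then have "diag_family (prod_encode (n, 0)) = diag_family i"
        by (simp add: diag_family_def n_def)
      moreover have "res A M (diag_teacher (restr f j)) = prod_encode (n, 0)" if "j \<ge> Suc k" for j A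
      proof -
        from that obtain j' where j: "j = Suc j'" by (cases j) auto
        have "f k \<in> set (restr f j)" using that by (auto simp: restr_def)
        then have "dropWhile (\<lambda>z. \<not> cert (pfst z) (psnd z)) (restr f j) \<noteq> []"
          using k fn[of k] by (auto simp: dropWhile_eq_Nil_conv intro!: bexI[of _ "f k"])
        then show ?thesis
          by (simp add: diag_teacher_def j restr res fn)
      qed
      ultimately show ?thesis by blast
    next
      case False
      \<comment> \<open>An enumerated target is nonempty, so with second component 0 it would be the
        full column and contain a certificate, which \<open>f\<close> would have to show.\<close>
      have "psnd i \<noteq> 0"
      proof
        assume "psnd i = 0"
        moreover have "f 0 \<in> diag_family i" using ran by blast
        ultimately obtain k where "cert n k" by (auto simp: diag_family_def n_def)
        moreover from this have "prod_encode (n, k) \<in> range f"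
          unfolding ran using \<open>psnd i = 0\<close> by (auto simp: diag_family_def n_def)
        then obtain j where "f j = prod_encode (n, k)" by (metis rangeE)
        ultimately show False using False by (metis prod_encode_inverse snd_conv)
      qed
      then have "diag_family (prod_encode (n, 1)) = diag_family i"
        by (simp add: diag_family_def n_def)
      moreover have "res A M (diag_teacher (restr f j)) = prod_encode (n, 1)" if "j \<ge> 1" for j A
      proof -
        from that obtain j' where j: "j = Suc j'" by (cases j) auto
        have "dropWhile (\<lambda>z. \<not> cert (pfst z) (psnd z)) (restr f j) = []"
          using False fn by (auto simp: dropWhile_eq_Nil_conv restr_def)
        then show ?thesis
          by (simp add: diag_teacher_def j restr res fn)
      qed
      ultimately show ?thesis by blast
    qed
    then obtain k b where kb: "diag_family (prod_encode (n, b)) = diag_family i"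
      "\<And>j A. j \<ge> k \<Longrightarrow> res A M (diag_teacher (restr f j)) = prod_encode (n, b)"
      by blast
    show "\<exists>k. card (set (diag_teacher (restr f k))) < poly [:3:] (mi diag_family (diag_family i)) \<and>
        length ([] :: (nat \<times> bool) list) < poly [:3:] (mi diag_family (diag_family i)) \<and>
        conv (diag_family i) M (diag_teacher (restr f k)) \<and>
        (\<forall>j\<ge>k. conv (diag_family i) M (diag_teacher (restr f j)) \<and>
          res (diag_family i) M (diag_teacher (restr f j)) =
            res (diag_family i) M (diag_teacher (restr f k))) \<and>
        diag_family (res (diag_family i) M (diag_teacher (restr f k))) = diag_family i"
      using kb card conv by (intro exI[of _ k]) auto
  qed
  then show ?thesis
    unfolding PSD_T_def using indexed_family_diag M(1) teacher_diag by blast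
qed

section \<open>The initial segments of the natural numbers\<close>

text \<open>Index 0 is given to the infinite set, as the segment of length 0 has no enumeration.
  Every member thus has exactly one index.\<close>

definition gold_family :: "nat \<Rightarrow> nat set" where
  "gold_family m = (if m = 0 then UNIV else {..<m})"

lemma gold_family_eq_iff: "gold_family m = gold_family n \<longleftrightarrow> m = n"
  by (auto simp: gold_family_def infinite_UNIV_nat dest: arg_cong[where f = finite])

lemma mi_gold_family: "mi gold_family (gold_family m) = m"
  unfolding mi_def gold_family_eq_iff by (rule Least_equality) auto

lemma indexed_family_gold: "indexed_family gold_family"
proof (rule indexed_familyI)
  let ?m = "\<lambda>u. pfst (psnd u)" and ?x = "\<lambda>u. psnd (psnd u)"
  show "computable (\<lambda>u. if ?m u = 0 then 0 else if ?x u < ?m u then 0 else 1)"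
    by (intro computable_intros)
qed (auto simp: gold_family_def)

text \<open>Computes the least \<open>x\<close> such that the code of the input belongs to the oracle set or \<open>x\<close>
  does not.\<close>

definition gold_learner :: recf where
  "gold_learner = Mu (Comp (PrimRec (Proj 0) Zero) [Comp Oracle [Proj 1], Comp Oracle [Proj 0]])"

text \<open>Primitive recursion serves as a conditional: its counter is the answer for the code
  \<open>c\<close>, and an answer 1 yields 0 and ends the search. Each evaluation makes two
  queries.\<close>

lemma ev_gold_body:
  "ev A (Comp (PrimRec (Proj 0) Zero) [Comp Oracle [Proj 1], Comp Oracle [Proj 0]]) [x, c]
     (if c \<in> A then 0 else if x \<in> A then 1 else 0) [c, x]"
proof -
  have "ev A (Comp Oracle [Proj i]) [x, c] (if [x, c] ! i \<in> A then 1 else 0) [[x, c] ! i]"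
    if "i < 2" for i
    using ev_comp[OF evs_cons[OF ev_proj[of i "[x, c]"] evs_nil] ev_oracle] that by simp
  from evs_cons[OF this[of 1] evs_cons[OF this[of 0] evs_nil]]
  have args: "evs A [Comp Oracle [Proj 1], Comp Oracle [Proj 0]] [x, c]
      [if c \<in> A then 1 else 0, if x \<in> A then 1 else 0] [c, x]" by simp
  have prim: "ev A (PrimRec (Proj 0) Zero) (0 # [b]) b []" for b
    using ev_prim0[OF ev_proj[of 0 "[b]"]] by simp
  have "ev A (PrimRec (Proj 0) Zero) (Suc 0 # [b]) 0 []" for b
    using ev_primS[OF prim ev_zero] by simp
  with prim have "ev A (PrimRec (Proj 0) Zero)
      [if c \<in> A then 1 else 0, if x \<in> A then 1 else 0]
      (if c \<in> A then 0 else if x \<in> A then 1 else 0) []" by auto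
  from ev_comp[OF args this] show ?thesis by simp
qed

lemma ev_gold_learner_member:
  assumes "c \<in> A"
  shows "ev A gold_learner [c] 0 [c, 0]"
  unfolding gold_learner_def
  by (intro ev_mu evmu_found) (use ev_gold_body[of A 0 c] assms in simp)

lemma ev_gold_learner_lessThan:
  assumes "m \<le> c"
  obtains q where "ev {..<m} gold_learner [c] m q" "length q = 2 * m + 2"
proof -
  let ?g = "Comp (PrimRec (Proj 0) Zero) [Comp Oracle [Proj 1], Comp Oracle [Proj 0]]"
  \<comment> \<open>Induction on the distance to \<open>m\<close>: the candidates
    \<open>m - i\<close> to \<open>m\<close> cost two queries each.\<close>
  have "\<exists>q. evmu {..<m} ?g [c] (m - i) m q \<and> length q = 2 * i + 2" if "i \<le> m" for i
    using that
  proof (induction i)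
    case 0
    have "ev {..<m} ?g [m, c] 0 [c, m]" using ev_gold_body[of "{..<m}" m c] assms by simp
    from evmu_found[OF this] show ?case by auto
  next
    case (Suc i)
    then obtain q where q: "evmu {..<m} ?g [c] (m - i) m q" "length q = 2 * i + 2" by auto
    have "ev {..<m} ?g [m - Suc i, c] (Suc 0) [c, m - Suc i]"
      using ev_gold_body[of "{..<m}" "m - Suc i" c] assms Suc.prems by simp
    from evmu_next[OF this, of m q] q Suc.prems show ?case
      by (intro exI[of _ "[c, m - Suc i] @ q"]) (simp add: Suc_diff_Suc)
  qed
  from this[of m] that show thesis by (auto simp: gold_learner_def intro: ev_mu)
qed

text \<open>Ensures that a code once outside the target \<open>{..<m}\<close> stays outside, so the
  learner never returns to the guess 0.\<close>

lemma list_encode_snoc: "list_encode \<sigma> \<le> list_encode (\<sigma> @ [x])"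
  by (induction \<sigma>) (auto simp: prod_encode_def triangle_mono)

lemma restr_Suc: "restr f (Suc n) = restr f n @ [f n]"
  by (simp add: restr_def)

lemma length_restr: "length (restr f n) = n"
  by (simp add: restr_def)

lemma list_encode_restr_mono: "m \<le> n \<Longrightarrow> list_encode (restr f m) \<le> list_encode (restr f n)"
proof (induction rule: dec_induct)
  case (step n)
  with list_encode_snoc[of "restr f n" "f n"] show ?case by (simp add: restr_Suc)
qed simp

text \<open>The code of the data is a growing test query. In the full set it is always a member, and
  the guess stays 0; in \<open>{..<m}\<close> it leaves the target after at most \<open>m\<close>
  data, and the search for the least missing number begins.\<close>

lemma gold_family_PSD_O: "gold_family \<in> PSD_O"
proof -
  have "psd_crit gold_family gold_learner (\<lambda>\<sigma> H. \<sigma>) [:5, 4:]"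
    unfolding psd_crit_def data_identity
  proof (intro allI impI)
    fix m f
    assume f: "enumeration f (gold_family m)"
    show "\<exists>n. card (set (restr f n)) < poly [:5, 4:] (mi gold_family (gold_family m)) \<and>
        length (hist (gold_family m) gold_learner (\<lambda>\<sigma> H. \<sigma>) f (Suc n))
          < poly [:5, 4:] (mi gold_family (gold_family m)) \<and>
        conv (gold_family m) gold_learner (restr f n) \<and>
        (\<forall>j\<ge>n. conv (gold_family m) gold_learner (restr f j) \<and>
           res (gold_family m) gold_learner (restr f j) =
             res (gold_family m) gold_learner (restr f n)) \<and>
        gold_family (res (gold_family m) gold_learner (restr f n)) = gold_family m"
    proof (cases "m = 0")
      case True
      have A: "gold_family m = UNIV" by (simp add: True gold_family_def)
      note r = res_queries_eq[OF ev_gold_learner_member[OF UNIV_I]]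
      show ?thesis
        unfolding A mi_gold_family[of 0, simplified gold_family_def, simplified]
        by (rule exI[of _ 0]) (simp add: r restr_def gold_family_def)
    next
      case False
      then have A: "gold_family m = {..<m}" by (simp add: gold_family_def)
      have len: "k \<le> list_encode (restr f k)" for k
        using length_le_list_encode[of "restr f k"] by (simp add: length_restr)
      define n where "n = (LEAST k. m \<le> list_encode (restr f k))"
      have n: "m \<le> list_encode (restr f n)" "n \<le> m"
        using LeastI[of "\<lambda>k. m \<le> list_encode (restr f k)" m, OF len]
          Least_le[of "\<lambda>k. m \<le> list_encode (restr f k)" m, OF len]
        by (simp_all add: n_def)
      have below: "list_encode (restr f k) < m" if "k < n" for k
        using not_less_Least[of k "\<lambda>k. m \<le> list_encode (restr f k)"] that by (simp add: n_def)
      have above: "conv {..<m} gold_learner (restr f j)" "res {..<m} gold_learner (restr f j) = m"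
        "length (queries {..<m} gold_learner (restr f j)) = 2 * m + 2" if "n \<le> j" for j
      proof -
        have "m \<le> list_encode (restr f j)"
          using n(1) list_encode_restr_mono[OF that, of f] by simp
        then obtain q where q: "ev {..<m} gold_learner [list_encode (restr f j)] m q"
          "length q = 2 * m + 2"
          by (rule ev_gold_learner_lessThan)
        from res_queries_eq[OF q(1)] q(2)
        show "conv {..<m} gold_learner (restr f j)" "res {..<m} gold_learner (restr f j) = m"
          "length (queries {..<m} gold_learner (restr f j)) = 2 * m + 2" by simp_all
      qed
      have "length (hist {..<m} gold_learner (\<lambda>\<sigma> H. \<sigma>) f k) = 2 * k" if "k \<le> n" for k
        using that
      proof (induction k)
        case (Suc k)
        then have "list_encode (restr f k) \<in> {..<m}" using below[of k] by simp
        from res_queries_eq[OF ev_gold_learner_member[OF this]] Suc show ?case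
          by (simp add: Let_def)
      qed simp
      \<comment> \<open>Two queries at each of the \<open>n\<close> earlier stages plus one full
        search: at most \<open>4 * m + 2\<close>, below the value \<open>4 * m + 5\<close> of the
        polynomial.\<close>
      then have "length (hist {..<m} gold_learner (\<lambda>\<sigma> H. \<sigma>) f (Suc n)) = 2 * n + (2 * m + 2)"
        using above[of n] by (simp add: Let_def)
      moreover have "card (set (restr f n)) \<le> n"
        using card_length[of "restr f n"] by (simp add: length_restr)
      ultimately show ?thesis
        unfolding A
        using above n A mi_gold_family[of m, unfolded A]
        by (intro exI[of _ n]) (simp del: hist.simps)
    qed
  qed
  then show ?thesis unfolding PSD_O_def using indexed_family_gold by blast
qed

text \<open>Gold's construction: each segment is presented until the learner names it, then the next
  number is added. In the limit all numbers are enumerated while the hypothesis changes infinitely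
  often.\<close>

lemma gold_family_not_PSD_T: "gold_family \<notin> PSD_T"
proof
  assume "gold_family \<in> PSD_T"
  then obtain M T p where M: "oracle_free M"
    and crit: "psd_crit gold_family M (\<lambda>\<sigma> H. T \<sigma>) p"
    by (auto simp: PSD_T_def)
  \<comment> \<open>Teacher and learner act as one map on data; \<open>oracle_free_res\<close>
    allows the empty oracle for every target.\<close>
  define h where "h \<sigma> = res {} M (T \<sigma>)" for \<sigma>
  have learn: "\<exists>n. \<forall>j\<ge>n. h (restr f j) = m" if "enumeration f (gold_family m)" for f m
  proof -
    from crit[unfolded psd_crit_def data_def, rule_format, OF that] obtain n where n:
      "\<forall>j\<ge>n. res (gold_family m) M (T (restr f j)) = res (gold_family m) M (T (restr f n))"
      "gold_family (res (gold_family m) M (T (restr f n))) = gold_family m"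
      by blast
    have "h (restr f j) = m" if "j \<ge> n" for j
    proof -
      have "h (restr f j) = h (restr f n)"
        using n(1)[rule_format, OF that]
        unfolding oracle_free_res[OF M, of "gold_family m"] h_def .
      also have "\<dots> = m"
        using n(2) unfolding oracle_free_res[OF M, of "gold_family m"] gold_family_eq_iff h_def .
      finally show ?thesis .
    qed
    then show ?thesis by blast
  qed
  have extend: "\<exists>\<tau>. prefix (\<sigma> @ [m]) \<tau> \<and> set \<tau> = {..<Suc m} \<and> h \<tau> = Suc m"
    if "set \<sigma> = {..<m}" for \<sigma> m
  proof -
    \<comment> \<open>Repeating \<open>m\<close> forever after \<open>\<sigma>\<close> enumerates
      the next segment, which forces the learner onto its only index.\<close>
    define f where "f i = (if i < length \<sigma> then \<sigma> ! i else m)" for i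
    have f: "restr f (length \<sigma> + k) = \<sigma> @ replicate k m" for k
      by (rule nth_equalityI) (auto simp: restr_def f_def nth_append)
    have "range f = {..<Suc m}"
    proof
      have "f i < Suc m" for i
      proof (cases "i < length \<sigma>")
        case True
        with nth_mem[OF True] that show ?thesis by (simp add: f_def)
      qed (simp add: f_def)
      then show "range f \<subseteq> {..<Suc m}" by auto
      have "x \<in> range f" if "x \<in> set \<sigma>" for x
      proof -
        from that obtain i where "i < length \<sigma>" "\<sigma> ! i = x" by (auto simp: in_set_conv_nth)
        then show ?thesis using rangeI[of f i] by (simp add: f_def)
      qed
      moreover have "m \<in> range f" using rangeI[of f "length \<sigma>"] by (simp add: f_def)
      ultimately show "{..<Suc m} \<subseteq> range f"
        unfolding lessThan_Suc \<open>set \<sigma> = {..<m}\<close>[symmetric] by blast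
    qed
    then have "enumeration f (gold_family (Suc m))"
      by (auto simp: enumeration_def gold_family_def)
    from learn[OF this] obtain n where n: "\<And>j. j \<ge> n \<Longrightarrow> h (restr f j) = Suc m" by blast
    \<comment> \<open>\<open>Suc n\<close> copies reach a position beyond \<open>n\<close> and
      contain \<open>m\<close> at least once.\<close>
    have "h (\<sigma> @ replicate (Suc n) m) = Suc m"
      using n[of "length \<sigma> + Suc n", unfolded f] by linarith
    moreover have "prefix (\<sigma> @ [m]) (\<sigma> @ replicate (Suc n) m)" by simp
    moreover have "set (\<sigma> @ replicate (Suc n) m) = {..<Suc m}"
      unfolding set_append set_replicate_Suc that by (simp add: lessThan_Suc)
    ultimately show ?thesis by blast
  qed
  define S where "S = rec_nat []
    (\<lambda>m \<sigma>. SOME \<tau>. prefix (\<sigma> @ [m]) \<tau> \<and> set \<tau> = {..<Suc m} \<and> h \<tau> = Suc m)"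
  have S_Suc: "prefix (S m @ [m]) (S (Suc m)) \<and> set (S (Suc m)) = {..<Suc m} \<and> h (S (Suc m)) = Suc m"
    if "set (S m) = {..<m}" for m
    using someI_ex[OF extend[OF that]] unfolding S_def nat.rec .
  have "set (S m) = {..<m}" for m
  proof (induction m)
    case 0
    show ?case by (simp add: S_def)
  next
    case (Suc m)
    from S_Suc[OF this] show ?case by blast
  qed
  with S_Suc have S: "set (S m) = {..<m} \<and> prefix (S m @ [m]) (S (Suc m)) \<and> h (S (Suc m)) = Suc m" for m
    by blast
  have mono: "prefix (S m) (S n)" if "m \<le> n" for m n
    using that
  proof (induction rule: dec_induct)
    case (step n)
    with S[of n] show ?case by (meson append_prefixD prefix_order.trans)
  qed simp
  have len: "m \<le> length (S m)" for m
  proof (induction m)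
    case (Suc m)
    with prefix_length_le[of "S m @ [m]" "S (Suc m)"] S[of m] show ?case by simp
  qed simp
  \<comment> \<open>The limit of the chain \<open>S\<close>; entry \<open>i\<close> exists because
    \<open>S (Suc i)\<close> has length at least \<open>Suc i\<close>.\<close>
  define f where "f i = S (Suc i) ! i" for i
  have f: "f i = S m ! i" if "i < length (S m)" for i m
  proof -
    have "i < length (S (Suc i))" using len[of "Suc i"] by simp
    then show ?thesis
      using that mono[of m "Suc i"] mono[of "Suc i" m]
      by (cases "m \<le> Suc i") (auto simp: f_def prefix_def nth_append)
  qed
  have restr: "restr f (length (S m)) = S m" for m
    by (rule nth_equalityI) (auto simp: restr_def f)
  have "m \<in> range f" for m
  proof -
    have "m \<in> set (restr f (length (S (Suc m))))" using S[of "Suc m"] by (simp add: restr)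
    then show ?thesis by (auto simp: restr_def)
  qed
  then have "enumeration f (gold_family 0)"
    by (auto simp: enumeration_def gold_family_def)
  from learn[OF this] obtain n where "\<And>j. j \<ge> n \<Longrightarrow> h (restr f j) = 0" by blast
  \<comment> \<open>The segment \<open>S (Suc n)\<close> is longer than \<open>n\<close>, yet on it
    the learner names \<open>Suc n\<close> instead of 0.\<close>
  from this[of "length (S (Suc n))"] len[of "Suc n"] S[of n] show False
    by (simp add: restr)
qed

section \<open>The hierarchy\<close>

text \<open>Composition with the first projection discards the code of the history.\<close>

lemma teacher_O_of_teacher:
  assumes "teacher T"
  shows "teacher_O (\<lambda>\<sigma> H. T \<sigma>)"
proof -
  from assms obtain t where t: "oracle_free t"
    "\<forall>\<sigma>. \<exists>q. ev {} t [list_encode \<sigma>] (list_encode (T \<sigma>)) q"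
    by (auto simp: teacher_def)
  have "\<exists>q. ev {} (Comp t [Proj 0]) [list_encode \<sigma>, enc_hist H] (list_encode (T \<sigma>)) q" for \<sigma> H
    using t(2) ev_comp[OF evs_cons[OF ev_proj[of 0 "[list_encode \<sigma>, enc_hist H]"] evs_nil]]
    by fastforce
  with t(1) assms show ?thesis
    unfolding teacher_O_def teacher_def by (intro conjI exI[of _ "Comp t [Proj 0]"]) auto
qed

lemma teacher_identity: "teacher (\<lambda>\<sigma>. \<sigma>)"
proof -
  have "ev {} (Proj 0) [list_encode \<sigma>] (list_encode \<sigma>) []" for \<sigma>
    using ev_proj[of 0 "[list_encode \<sigma>]"] by simp
  then show ?thesis
    unfolding teacher_def by (intro conjI exI[of _ "Proj 0"]) auto
qed

theorem theorem4p6: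
  shows "(PSD \<subset> PSD_O \<and> PSD_O \<subset> PSD_TO)
       \<and> (PSD \<subset> PSD_T \<and> PSD_T \<subset> PSD_TO)
       \<and> PSD_O - PSD_T \<noteq> {}
       \<and> PSD_T - PSD_O \<noteq> {}"
proof -
  have "PSD \<subseteq> PSD_O" unfolding PSD_def PSD_O_def by blast
  moreover have "PSD \<subseteq> PSD_T"
    unfolding PSD_def PSD_T_def using teacher_identity by blast
  moreover have "PSD_O \<subseteq> PSD_TO"
    unfolding PSD_O_def PSD_TO_def using teacher_O_of_teacher[OF teacher_identity] by blast
  moreover have "PSD_T \<subseteq> PSD_TO"
    unfolding PSD_T_def PSD_TO_def using teacher_O_of_teacher by blast
  \<comment> \<open>The two witnesses also give all strictness: \<open>gold_family\<close> separates
    \<open>PSD\<close> from \<open>PSD_O\<close> and \<open>PSD_T\<close> from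
    \<open>PSD_TO\<close>, and \<open>diag_family\<close> separates \<open>PSD\<close> from
    \<open>PSD_T\<close> and \<open>PSD_O\<close> from \<open>PSD_TO\<close>.\<close>
  ultimately show ?thesis
    using gold_family_PSD_O gold_family_not_PSD_T diag_family_PSD_T diag_family_not_PSD_O by blast
qed

end
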